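(* Let $m,n\ge 1$ be integers, let $X=\{x_1,\dots,x_m\}$ be a set of $m$ (distinct) points and $Y=\{y_1,\dots,y_n\}$ a set of $n$ (distinct) points, and let $c:X\times Y\to\mathbb{R}$ be an arbitrary cost function. Let $\mu=\frac1m\sum_{i=1}^m\delta_{x_i}$ and $\nu=\frac1n\sum_{j=1}^n\delta_{y_j}$. Then there is a solution $\gamma$ of the Kantorovich problem for $\mu,\nu,c$ such that mass from each point in $X$ is moved to at most $n/\gcd(m,n)$ different points in $Y$, and each point in $Y$ receives mass from at most $m/\gcd(m,n)$ different points in $X$. That is, $\#\{j:\gamma(\{(x_i,y_j)\})>0\}\le n/\gcd(m,n)$ for every $1\le i\le m$, and $\#\{i:\gamma(\{(x_i,y_j)\})>0\}\le m/\gcd(m,n)$ for every $1\le j\le n$.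
   Context: Here $\delta_x$ denotes the Dirac measure at $x$. Given probability measures $\mu$ on $X$ and $\nu$ on $Y$ and a cost $c(x,y)$ of transporting mass from $x$ to $y$, the Kantorovich problem is to minimize $\int_{X\times Y}c(x,y)\,d\gamma(x,y)$ over all probability measures $\gamma$ on $X\times Y$ with marginals $\mu$ and $\nu$. A solution of the Kantorovich problem is such a $\gamma$ attaining the minimum. Mass from $x\in X$ is moved to $y\in Y$ (equivalently, $y$ receives mass from $x$) under $\gamma$ if $\gamma(\{(x,y)\})>0$. *)

theory Defs
  imports "HOL-Probability.Probability"
begin

text \<open>
  The measure \<open>(1/m) * (\<delta>_(x 1) + ... + \<delta>_(x m))\<close> on the finite set \<open>{x 1, ..., x m}\<close>, all of
  whose subsets are measurable. The Dirac measure of the library is \<^const>\<open>return\<close>.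
\<close>

definition dirac_average :: "nat \<Rightarrow> (nat \<Rightarrow> 'a) \<Rightarrow> 'a measure" where
  "dirac_average m x =
     measure_of (x ` {1..m}) (Pow (x ` {1..m}))
       (\<lambda>A. ennreal (1 / real m) * (\<Sum>i = 1..m. emeasure (return (count_space (x ` {1..m})) (x i)) A))"

definition couplings :: "'a measure \<Rightarrow> 'b measure \<Rightarrow> ('a \<times> 'b) measure set" where
  "couplings \<mu> \<nu> =
     {\<gamma>. prob_space \<gamma> \<and> sets \<gamma> = sets (\<mu> \<Otimes>\<^sub>M \<nu>) \<and> distr \<gamma> \<mu> fst = \<mu> \<and> distr \<gamma> \<nu> snd = \<nu>}"

text \<open>
  The Bochner integral of a non-integrable function is 0, so the following definition is meant
  for costs that are integrable with respect to every coupling. On finite spaces with all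
  subsets measurable, every cost is.
\<close>

definition kantorovich_solution ::
    "'a measure \<Rightarrow> 'b measure \<Rightarrow> ('a \<times> 'b \<Rightarrow> real) \<Rightarrow> ('a \<times> 'b) measure \<Rightarrow> bool" where
  "kantorovich_solution \<mu> \<nu> c \<gamma> \<longleftrightarrow>
     \<gamma> \<in> couplings \<mu> \<nu> \<and>
     (\<forall>\<gamma>' \<in> couplings \<mu> \<nu>. integral\<^sup>L \<gamma> c \<le> integral\<^sup>L \<gamma>' c)"

lemma space_dirac_average [simp]: "space (dirac_average m x) = x ` {1..m}"
  by (simp add: dirac_average_def space_measure_of_conv)

lemma sets_dirac_average [simp]: "sets (dirac_average m x) = Pow (x ` {1..m})"
  by (simp add: dirac_average_def sigma_algebra.sigma_sets_eq[OF sigma_algebra_Pow])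

lemma emeasure_dirac_average:
  assumes A: "A \<subseteq> x ` {1..m}"
  shows "emeasure (dirac_average m x) A =
    ennreal (1 / real m) * (\<Sum>i = 1..m. emeasure (return (count_space (x ` {1..m})) (x i)) A)"
proof (rule emeasure_measure_of[OF dirac_average_def])
  let ?X = "x ` {1..m}"
  let ?f = "\<lambda>A. ennreal (1 / real m) * (\<Sum>i = 1..m. emeasure (return (count_space ?X) (x i)) A)"
  show "countably_additive (sets (dirac_average m x)) ?f"
  proof (rule countably_additiveI)
    fix B :: "nat \<Rightarrow> 'a set"
    assume B: "range B \<subseteq> sets (dirac_average m x)" "disjoint_family B"
      "(\<Union>i. B i) \<in> sets (dirac_average m x)"
    have B': "range B \<subseteq> sets (return (count_space ?X) (x i))" for i
      using B(1) by simp
    have "(\<Sum>k. ?f (B k)) =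
        ennreal (1 / real m) * (\<Sum>i = 1..m. (\<Sum>k. emeasure (return (count_space ?X) (x i)) (B k)))"
      by (simp add: suminf_sum)
    also have "\<dots> = ?f (\<Union>k. B k)"
      by (subst suminf_emeasure[OF B' B(2)]) simp
    finally show "(\<Sum>k. ?f (B k)) = ?f (\<Union>k. B k)" .
  qed
qed (use A in \<open>auto simp: positive_def\<close>)

lemma dirac_average_eq_uniform_count_measure:
  assumes "inj_on x {1..m}"
  shows "dirac_average m x = uniform_count_measure (x ` {1..m})"
proof (rule measure_eqI)
  fix A assume "A \<in> sets (dirac_average m x)"
  then have A: "A \<subseteq> x ` {1..m}" by simp
  have inj: "inj_on x {i \<in> {1..m}. x i \<in> A}"
    using assms by (rule inj_on_subset) auto
  have im: "x ` {i \<in> {1..m}. x i \<in> A} = A"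
    using A by auto
  have "(\<Sum>i = 1..m. emeasure (return (count_space (x ` {1..m})) (x i)) A)
      = (\<Sum>i = 1..m. indicator A (x i))"
    using A by (intro sum.cong refl emeasure_return) simp
  also have "\<dots> = of_nat (card {i \<in> {1..m}. x i \<in> A})"
    by (simp add: indicator_def sum.If_cases Int_def)
  also have "card {i \<in> {1..m}. x i \<in> A} = card A"
    using card_image[OF inj] im by simp
  finally show "emeasure (dirac_average m x) A = emeasure (uniform_count_measure (x ` {1..m})) A"
    using A assms
    by (simp add: emeasure_dirac_average emeasure_uniform_count_measure card_image
        ennreal_of_nat_eq_real_of_nat ennreal_mult[symmetric])
qed (simp add: sets_uniform_count_measure)

end

theory Submission
  imports Defs
begin

text \<open>
  Multiply the plans by \<open>lcm m n\<close>, so that all row sums become \<open>n / gcd m n\<close> and all column sums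
  \<open>m / gcd m n\<close>. If these integers are the sums of nonnegative integer entries, they bound the
  number of positive entries, so an optimal plan with integer entries is enough.
  A row or column with one fractional entry contains a second one. The fractional entries are
  therefore at least as numerous as the rows and columns they meet, and they carry a nonzero
  perturbation with zero margins. Following it in a direction in which the cost does not increase,
  until an entry becomes an integer, lowers the number of fractional entries. Hence every plan is
  dominated by an integral one, and of these there are only finitely many.
\<close>

section \<open>Linear algebra: underdetermined homogeneous systems\<close>

text \<open>Gaussian elimination, one equation per induction step: an equation that vanishes on
  \<open>E\<close> is dropped, and any other is solved for one unknown, which lowers both counts by
  one.\<close>

lemma homogeneous_system_nontrivial_solution:
  fixes M :: "'v \<Rightarrow> 'e \<Rightarrow> 'k::field"
  assumes "finite V" "finite E" "card V < card E"
  shows "\<exists>d. (\<exists>e\<in>E. d e \<noteq> 0) \<and> (\<forall>v\<in>V. (\<Sum>e\<in>E. M v e * d e) = 0)"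
  using assms
proof (induction V arbitrary: E M rule: finite_induct)
  case empty
  then have "E \<noteq> {}" by auto
  then show ?case by (intro exI[of _ "\<lambda>_. 1"]) auto
next
  case (insert v V)
  show ?case
  proof (cases "\<forall>e\<in>E. M v e = 0")
    case True
    have "card V < card E" using insert by simp
    from insert.IH[OF insert.prems(1) this, of M] obtain d where
      "\<exists>e\<in>E. d e \<noteq> 0" "\<forall>v\<in>V. (\<Sum>e\<in>E. M v e * d e) = 0" by blast
    with True show ?thesis by (intro exI[of _ d]) auto
  next
    case False
    then obtain e0 where e0: "e0 \<in> E" "M v e0 \<noteq> 0" by blast
    define E' where "E' = E - {e0}"
    have E': "finite E'" "card V < card E'" "E = insert e0 E'" "e0 \<notin> E'"
      using insert e0 by (auto simp: E'_def)
    \<comment> \<open>\<open>N\<close> is the system left after substituting for the unknown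
      \<open>e0\<close> the value that equation \<open>v\<close> forces on it.\<close>
    define N where "N w e = M w e - M w e0 * M v e / M v e0" for w e
    from insert.IH[OF E'(1,2), of N] obtain d where d:
      "\<exists>e\<in>E'. d e \<noteq> 0" "\<forall>w\<in>V. (\<Sum>e\<in>E'. N w e * d e) = 0" by blast
    \<comment> \<open>Back substitution: the value at \<open>e0\<close> is the one that makes
      equation \<open>v\<close> hold.\<close>
    define d' where "d' = d(e0 := - (\<Sum>e\<in>E'. M v e * d e) / M v e0)"
    have sum_d': "(\<Sum>e\<in>E. M w e * d' e) = M w e0 * d' e0 + (\<Sum>e\<in>E'. M w e * d e)" for w
    proof -
      have "(\<Sum>e\<in>E'. M w e * d' e) = (\<Sum>e\<in>E'. M w e * d e)"
        using E'(4) by (intro sum.cong) (auto simp: d'_def)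
      then show ?thesis using E' by simp
    qed
    have "(\<Sum>e\<in>E. M w e * d' e) = 0" if w: "w \<in> V" for w
    proof -
      have "0 = (\<Sum>e\<in>E'. M w e * d e - (M w e0 / M v e0) * (M v e * d e))"
        using d(2) w by (simp add: N_def left_diff_distrib mult.assoc)
      also have "\<dots> = (\<Sum>e\<in>E'. M w e * d e) - (M w e0 / M v e0) * (\<Sum>e\<in>E'. M v e * d e)"
        by (simp add: sum_subtractf sum_distrib_left)
      finally show ?thesis unfolding sum_d' by (simp add: d'_def)
    qed
    moreover have "(\<Sum>e\<in>E. M v e * d' e) = 0"
      unfolding sum_d' using e0 by (simp add: d'_def)
    moreover have "\<exists>e\<in>E. d' e \<noteq> 0"
      using d(1) E' by (auto simp: d'_def)
    ultimately show ?thesis by (intro exI[of _ d']) auto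
  qed
qed

section \<open>Perturbations with zero margins\<close>

text \<open>The fibres of \<open>f\<close> over its image partition \<open>F\<close>, and each has
  at least two elements. With \<open>f\<close> a projection, this counts the rows or columns that
  \<open>F\<close> meets.\<close>

lemma double_card_image_le:
  assumes "finite F" and "\<And>z. z \<in> F \<Longrightarrow> \<exists>w\<in>F. w \<noteq> z \<and> f w = f z"
  shows "2 * card (f ` F) \<le> card F"
proof -
  have "2 \<le> card {z \<in> F. f z = u}" if "u \<in> f ` F" for u
  proof -
    from that obtain z where z: "z \<in> F" "f z = u" by auto
    with assms(2) obtain w where "w \<in> F" "w \<noteq> z" "f w = u" by metis
    then have "card {z, w} \<le> card {z \<in> F. f z = u}"
      using z assms(1) by (intro card_mono) auto
    then show ?thesis using \<open>w \<noteq> z\<close> by simp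
  qed
  then have "(\<Sum>u\<in>f ` F. 2) \<le> (\<Sum>u\<in>f ` F. card {z \<in> F. f z = u})"
    by (intro sum_mono) auto
  also have "\<dots> = card F"
    using sum.image_gen[OF assms(1), of "\<lambda>_. 1::nat" f] by simp
  finally show ?thesis by simp
qed

text \<open>Read \<open>F\<close> as the edges of a bipartite graph in which every vertex met has
  degree at least two. Such a graph contains a cycle, and alternating signs along it would give
  \<open>d\<close>; a dimension count replaces the search for the cycle.\<close>

lemma ex_zero_margin_perturbation:
  fixes F :: "('a \<times> 'b) set"
  assumes X: "finite X" and Y: "finite Y" and F: "F \<subseteq> X \<times> Y" "F \<noteq> {}"
    and row: "\<And>u v. (u, v) \<in> F \<Longrightarrow> \<exists>v'. v' \<noteq> v \<and> (u, v') \<in> F"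
    and col: "\<And>u v. (u, v) \<in> F \<Longrightarrow> \<exists>u'. u' \<noteq> u \<and> (u', v) \<in> F"
  shows "\<exists>d :: 'a \<times> 'b \<Rightarrow> real. (\<forall>z. z \<notin> F \<longrightarrow> d z = 0) \<and> (\<exists>z\<in>F. d z \<noteq> 0) \<and>
    (\<forall>u\<in>X. (\<Sum>v\<in>Y. d (u, v)) = 0) \<and> (\<forall>v\<in>Y. (\<Sum>u\<in>X. d (u, v)) = 0)"
proof -
  have finF: "finite F" using F X Y by (meson finite_SigmaI finite_subset)
  obtain u0 v0 where z0: "(u0, v0) \<in> F" using F(2) by auto
  have R: "2 * card (fst ` F) \<le> card F"
    using row by (intro double_card_image_le finF) (metis fst_conv prod.collapse prod.inject)
  have C: "2 * card (snd ` F) \<le> card F"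
    using col by (intro double_card_image_le finF) (metis snd_conv prod.collapse prod.inject)
  have v0: "v0 \<in> snd ` F" using z0 by force
  txt \<open>The row and column equations have one dependency, since both families add up to
    the total sum. Dropping the equation of column \<open>v0\<close> leaves fewer equations than unknowns.\<close>
  define V where "V = Inl ` (fst ` F) \<union> Inr ` (snd ` F - {v0})"
  have finV: "finite V" using finF by (simp add: V_def)
  have "card V \<le> card (fst ` F) + card (snd ` F - {v0})"
    unfolding V_def by (rule order_trans[OF card_Un_le])
      (intro add_mono card_image_le finite_imageI finite_Diff finF)
  also have "\<dots> < card (fst ` F) + card (snd ` F)"
    using v0 finF by (intro add_strict_left_mono psubset_card_mono) auto
  also have "\<dots> \<le> card F" using R C by linarith
  finally have cardV: "card V < card F" .
  \<comment> \<open>\<open>M\<close> is the vertex-edge incidence matrix: \<open>Inl u\<close>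
    stands for the equation of row \<open>u\<close>, \<open>Inr v\<close> for that of column
    \<open>v\<close>.\<close>
  define M :: "'a + 'b \<Rightarrow> 'a \<times> 'b \<Rightarrow> real"
    where "M w z = (case w of Inl u \<Rightarrow> of_bool (fst z = u) | Inr v \<Rightarrow> of_bool (snd z = v))" for w z
  from homogeneous_system_nontrivial_solution[OF finV finF cardV, of M] obtain e where
    e: "\<exists>z\<in>F. e z \<noteq> 0" "\<And>w. w \<in> V \<Longrightarrow> (\<Sum>z\<in>F. M w z * e z) = 0" by blast
  define d where "d z = (if z \<in> F then e z else 0)" for z
  have sum_d: "(\<Sum>z\<in>F. M w z * e z) = (\<Sum>z\<in>X \<times> Y. M w z * d z)" for w
    using F X Y by (intro sum.mono_neutral_cong_left) (auto simp: d_def)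
  have row_sum: "(\<Sum>z\<in>X \<times> Y. M (Inl u) z * d z) = (\<Sum>v\<in>Y. d (u, v))" if "u \<in> X" for u
  proof -
    have "(\<Sum>z\<in>X \<times> Y. M (Inl u) z * d z) = (\<Sum>a\<in>X. if a = u then (\<Sum>v\<in>Y. d (u, v)) else 0)"
      unfolding sum.cartesian_product' by (intro sum.cong) (auto simp: M_def)
    then show ?thesis using that X by simp
  qed
  have col_sum: "(\<Sum>z\<in>X \<times> Y. M (Inr v) z * d z) = (\<Sum>u\<in>X. d (u, v))" if "v \<in> Y" for v
  proof -
    have "(\<Sum>z\<in>X \<times> Y. M (Inr v) z * d z) = (\<Sum>a\<in>X. \<Sum>b\<in>Y. if b = v then d (a, v) else 0)"
      unfolding sum.cartesian_product' by (intro sum.cong) (auto simp: M_def)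
    then show ?thesis using that Y by simp
  qed
  have rows: "(\<Sum>v\<in>Y. d (u, v)) = 0" if u: "u \<in> X" for u
  proof (cases "u \<in> fst ` F")
    case True
    then have "Inl u \<in> V" by (simp add: V_def)
    from e(2)[OF this] show ?thesis using sum_d row_sum[OF u] by simp
  next
    case False
    then show ?thesis by (intro sum.neutral) (force simp: d_def)
  qed
  have cols: "(\<Sum>u\<in>X. d (u, v)) = 0" if v: "v \<in> Y" and "v \<noteq> v0" for v
  proof (cases "v \<in> snd ` F")
    case True
    then have "Inr v \<in> V" using \<open>v \<noteq> v0\<close> by (simp add: V_def)
    from e(2)[OF this] show ?thesis using sum_d col_sum[OF v] by simp
  next
    case False
    then show ?thesis by (intro sum.neutral) (force simp: d_def)
  qed
  have v0Y: "v0 \<in> Y" using z0 F by auto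
  \<comment> \<open>The dropped equation is recovered by summing all entries in two ways: by rows
    the total is 0, and by columns only column \<open>v0\<close> is left.\<close>
  have "0 = (\<Sum>u\<in>X. \<Sum>v\<in>Y. d (u, v))" using rows by simp
  also have "\<dots> = (\<Sum>v\<in>Y. \<Sum>u\<in>X. d (u, v))" by (rule sum.swap)
  also have "\<dots> = (\<Sum>u\<in>X. d (u, v0))"
    using Y v0Y cols by (subst sum.remove[of _ v0]) (auto intro!: sum.neutral)
  finally have "(\<Sum>u\<in>X. d (u, v0)) = 0" by simp
  with cols have cols': "(\<Sum>u\<in>X. d (u, v)) = 0" if "v \<in> Y" for v
    using that by (cases "v = v0") auto
  show ?thesis
    by (rule exI[of _ d]) (use e(1) rows cols' in \<open>auto simp: d_def\<close>)
qed

section \<open>Integral optimal transport plans\<close>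

text \<open>Arbitrary margins let the same notion cover both the probability weights and their
  integer multiples. Values outside \<open>X \<times> Y\<close> are left free.\<close>

definition transport_plan ::
    "'a set \<Rightarrow> 'b set \<Rightarrow> ('a \<Rightarrow> real) \<Rightarrow> ('b \<Rightarrow> real) \<Rightarrow> ('a \<times> 'b \<Rightarrow> real) \<Rightarrow> bool" where
  "transport_plan X Y r s A \<longleftrightarrow>
     (\<forall>z\<in>X \<times> Y. 0 \<le> A z) \<and> (\<forall>u\<in>X. (\<Sum>v\<in>Y. A (u, v)) = r u) \<and> (\<forall>v\<in>Y. (\<Sum>u\<in>X. A (u, v)) = s v)"

text \<open>Were all other terms integers, \<open>f i\<close> would be a difference of two
  integers.\<close>

lemma ex_other_nonint:
  fixes f :: "'i \<Rightarrow> real"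
  assumes "finite I" "sum f I \<in> \<int>" "i \<in> I" "f i \<notin> \<int>"
  shows "\<exists>j\<in>I. j \<noteq> i \<and> f j \<notin> \<int>"
proof (rule ccontr)
  assume "\<not> ?thesis"
  then have "sum f (I - {i}) \<in> \<int>" by (intro Ints_sum) auto
  with assms(2) have "sum f I - sum f (I - {i}) \<in> \<int>" by (rule Ints_diff)
  with assms show False by (simp add: sum.remove)
qed

text \<open>Integer entries stay fixed because the perturbation vanishes on them, and the motion
  stops at the first moment a fractional entry becomes an integer. No entry falls below its floor,
  so nonnegativity survives.\<close>

lemma transport_plan_reduce_nonint:
  fixes c :: "'a \<times> 'b \<Rightarrow> real"
  assumes X: "finite X" and Y: "finite Y"
    and r: "\<And>u. u \<in> X \<Longrightarrow> r u \<in> \<int>" and s: "\<And>v. v \<in> Y \<Longrightarrow> s v \<in> \<int>"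
    and A: "transport_plan X Y r s A" and ne: "{z \<in> X \<times> Y. A z \<notin> \<int>} \<noteq> {}"
  obtains B where "transport_plan X Y r s B"
    "(\<Sum>z\<in>X \<times> Y. c z * B z) \<le> (\<Sum>z\<in>X \<times> Y. c z * A z)"
    "{z \<in> X \<times> Y. B z \<notin> \<int>} \<subset> {z \<in> X \<times> Y. A z \<notin> \<int>}"
proof -
  define F where "F = {z \<in> X \<times> Y. A z \<notin> \<int>}"
  have FXY: "F \<subseteq> X \<times> Y" and finF: "finite F" using X Y by (auto simp: F_def)
  have row: "\<exists>v'. v' \<noteq> v \<and> (u, v') \<in> F" if "(u, v) \<in> F" for u v
    using ex_other_nonint[OF Y, of "\<lambda>v. A (u, v)" v] that A r
    by (auto simp: F_def transport_plan_def)
  have col: "\<exists>u'. u' \<noteq> u \<and> (u', v) \<in> F" if "(u, v) \<in> F" for u v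
    using ex_other_nonint[OF X, of "\<lambda>u. A (u, v)" u] that A s
    by (auto simp: F_def transport_plan_def)
  obtain e :: "'a \<times> 'b \<Rightarrow> real" where e:
    "\<forall>z. z \<notin> F \<longrightarrow> e z = 0" "\<exists>z\<in>F. e z \<noteq> 0"
    "\<forall>u\<in>X. (\<Sum>v\<in>Y. e (u, v)) = 0" "\<forall>v\<in>Y. (\<Sum>u\<in>X. e (u, v)) = 0"
    using ex_zero_margin_perturbation[OF X Y FXY ne[folded F_def] row col] by blast
  \<comment> \<open>Both \<open>e\<close> and its negative have zero margins; the sign is chosen so
    that the cost does not increase.\<close>
  define \<sigma> :: real where "\<sigma> = (if (\<Sum>z\<in>X \<times> Y. c z * e z) \<le> 0 then 1 else - 1)"
  define d where "d z = \<sigma> * e z" for z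
  have \<sigma>: "\<sigma> \<noteq> 0" by (simp add: \<sigma>_def)
  have "(\<Sum>z\<in>X \<times> Y. c z * d z) = \<sigma> * (\<Sum>z\<in>X \<times> Y. c z * e z)"
    by (simp add: d_def sum_distrib_left mult_ac)
  then have cost_d: "(\<Sum>z\<in>X \<times> Y. c z * d z) \<le> 0" by (simp add: \<sigma>_def)
  have d: "\<And>z. z \<notin> F \<Longrightarrow> d z = 0" "\<exists>z\<in>F. d z \<noteq> 0"
    "\<And>u. u \<in> X \<Longrightarrow> (\<Sum>v\<in>Y. d (u, v)) = 0" "\<And>v. v \<in> Y \<Longrightarrow> (\<Sum>u\<in>X. d (u, v)) = 0"
    using e \<sigma> by (auto simp: d_def sum_distrib_left[symmetric])
  define G where "G = {z \<in> F. d z \<noteq> 0}"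
  have G: "finite G" "G \<noteq> {}" using finF d(2) by (auto simp: G_def)
  txt \<open>\<open>\<tau> z\<close> is the time at which the entry \<open>A z + t * d z\<close> first becomes an integer.\<close>
  define \<tau> where "\<tau> z = (if d z > 0 then (\<lceil>A z\<rceil> - A z) / d z else (\<lfloor>A z\<rfloor> - A z) / d z)" for z
  define t where "t = Min (\<tau> ` G)"
  have "t \<in> \<tau> ` G" unfolding t_def using G by (intro Min_in) auto
  then obtain z0 where z0: "z0 \<in> G" "t = \<tau> z0" by auto
  have t_le: "t \<le> \<tau> z" if "z \<in> G" for z using that G by (simp add: t_def)
  have "0 \<le> \<tau> z" for z
    by (auto simp: \<tau>_def intro!: divide_nonneg_pos divide_nonpos_nonpos)
  then have t0: "0 \<le> t" using z0 by simp
  define B where "B z = A z + t * d z" for z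
  \<comment> \<open>At time \<open>t\<close> the entry at the minimizer \<open>z0\<close> reaches
    its ceiling or its floor. Since \<open>z0\<close> lies in \<open>F\<close>, this makes the final
    inclusion strict.\<close>
  have B_int: "B z0 \<in> \<int>" using z0 by (auto simp: B_def \<tau>_def G_def)
  \<comment> \<open>Entries with \<open>d z \<ge> 0\<close> do not decrease; a decreasing one
    reaches its floor only at time \<open>\<tau> z\<close>, which is not before
    \<open>t\<close>.\<close>
  have B_ge: "\<lfloor>A z\<rfloor> \<le> B z" for z
  proof (cases "d z \<ge> 0")
    case True
    then have "A z \<le> B z" using t0 by (simp add: B_def)
    then show ?thesis using of_int_floor_le[of "A z"] by linarith
  next
    case False
    then have "z \<in> G" using d(1)[of z] by (auto simp: G_def)
    from t_le[OF this] False have "t \<le> (\<lfloor>A z\<rfloor> - A z) / d z" by (simp add: \<tau>_def)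
    with False show ?thesis by (simp add: B_def neg_le_divide_eq)
  qed
  have "transport_plan X Y r s B"
    unfolding transport_plan_def
  proof (intro conjI ballI)
    fix z assume "z \<in> X \<times> Y"
    then have "0 \<le> \<lfloor>A z\<rfloor>" using A by (auto simp: transport_plan_def)
    with B_ge[of z] show "0 \<le> B z" by linarith
  next
    fix u assume "u \<in> X"
    then show "(\<Sum>v\<in>Y. B (u, v)) = r u"
      using A d(3) by (simp add: B_def transport_plan_def sum.distrib sum_distrib_left[symmetric])
  next
    fix v assume "v \<in> Y"
    then show "(\<Sum>u\<in>X. B (u, v)) = s v"
      using A d(4) by (simp add: B_def transport_plan_def sum.distrib sum_distrib_left[symmetric])
  qed
  moreover have "(\<Sum>z\<in>X \<times> Y. c z * B z) \<le> (\<Sum>z\<in>X \<times> Y. c z * A z)"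
  proof -
    have "(\<Sum>z\<in>X \<times> Y. c z * B z) = (\<Sum>z\<in>X \<times> Y. c z * A z) + t * (\<Sum>z\<in>X \<times> Y. c z * d z)"
      by (simp add: B_def sum.distrib sum_distrib_left algebra_simps)
    then show ?thesis using t0 cost_d by (simp add: mult_nonneg_nonpos)
  qed
  moreover have "{z \<in> X \<times> Y. B z \<notin> \<int>} \<subset> F"
  proof
    show "{z \<in> X \<times> Y. B z \<notin> \<int>} \<subseteq> F"
    proof
      fix z assume z: "z \<in> {z \<in> X \<times> Y. B z \<notin> \<int>}"
      show "z \<in> F"
      proof (rule ccontr)
        assume "z \<notin> F"
        with z d(1)[of z] show False by (auto simp: F_def B_def)
      qed
    qed
    show "{z \<in> X \<times> Y. B z \<notin> \<int>} \<noteq> F" using z0 B_int by (auto simp: G_def)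
  qed
  ultimately show thesis by (rule that[folded F_def])
qed

text \<open>Strong induction on the number of fractional entries, which each reduction strictly
  lowers.\<close>

lemma ex_integral_transport_plan_le:
  fixes c :: "'a \<times> 'b \<Rightarrow> real"
  assumes X: "finite X" and Y: "finite Y"
    and r: "\<And>u. u \<in> X \<Longrightarrow> r u \<in> \<int>" and s: "\<And>v. v \<in> Y \<Longrightarrow> s v \<in> \<int>"
    and "transport_plan X Y r s A"
  shows "\<exists>B. transport_plan X Y r s B \<and> (\<forall>z\<in>X \<times> Y. B z \<in> \<int>) \<and>
    (\<Sum>z\<in>X \<times> Y. c z * B z) \<le> (\<Sum>z\<in>X \<times> Y. c z * A z)"
  using assms(5)
proof (induction "card {z \<in> X \<times> Y. A z \<notin> \<int>}" arbitrary: A rule: less_induct)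
  case less
  show ?case
  proof (cases "{z \<in> X \<times> Y. A z \<notin> \<int>} = {}")
    case True
    then show ?thesis using less.prems by (intro exI[of _ A]) auto
  next
    case False
    obtain B where B: "transport_plan X Y r s B"
      "(\<Sum>z\<in>X \<times> Y. c z * B z) \<le> (\<Sum>z\<in>X \<times> Y. c z * A z)"
      "{z \<in> X \<times> Y. B z \<notin> \<int>} \<subset> {z \<in> X \<times> Y. A z \<notin> \<int>}"
      by (rule transport_plan_reduce_nonint[OF X Y r s less.prems False, where c = c])
    have "card {z \<in> X \<times> Y. B z \<notin> \<int>} < card {z \<in> X \<times> Y. A z \<notin> \<int>}"
      by (rule psubset_card_mono[OF _ B(3)]) (use X Y in auto)
    from less.hyps[OF this B(1)] B(2) show ?thesis by (meson order_trans)
  qed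
qed

text \<open>Integral plans have only finitely many costs, so a cheapest one exists; every real plan
  is dominated by an integral one, so it is optimal among all plans. No compactness argument is
  involved.\<close>

lemma ex_integral_optimal_transport_plan:
  fixes c :: "'a \<times> 'b \<Rightarrow> real"
  assumes X: "finite X" and Y: "finite Y"
    and r: "\<And>u. u \<in> X \<Longrightarrow> r u \<in> \<int>" and s: "\<And>v. v \<in> Y \<Longrightarrow> s v \<in> \<int>"
    and A: "transport_plan X Y r s A"
  obtains B where "transport_plan X Y r s B" "\<And>z. z \<in> X \<times> Y \<Longrightarrow> B z \<in> \<int>"
    "\<And>A'. transport_plan X Y r s A' \<Longrightarrow>
       (\<Sum>z\<in>X \<times> Y. c z * B z) \<le> (\<Sum>z\<in>X \<times> Y. c z * A' z)"
proof -
  define cost where "cost B = (\<Sum>z\<in>X \<times> Y. c z * B z)" for B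
  define I where "I = {B. transport_plan X Y r s B \<and> (\<forall>z\<in>X \<times> Y. B z \<in> \<int>)}"
  \<comment> \<open>An entry is at most the total mass, so an integer entry is at most its floor
    \<open>K\<close>.\<close>
  define K where "K = \<lfloor>\<Sum>u\<in>X. r u\<rfloor>"
  have bound: "restrict B (X \<times> Y) \<in> X \<times> Y \<rightarrow>\<^sub>E of_int ` {0..K}" if B: "B \<in> I" for B
  proof (rule restrict_PiE_iff[THEN iffD2], rule ballI)
    fix z assume z: "z \<in> X \<times> Y"
    have nonneg: "0 \<le> B w" if "w \<in> X \<times> Y" for w
      using B that by (auto simp: I_def transport_plan_def)
    have "B z \<le> (\<Sum>w\<in>X \<times> Y. B w)"
      using nonneg z X Y by (intro member_le_sum) auto
    also have "\<dots> = (\<Sum>u\<in>X. r u)"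
      unfolding sum.cartesian_product'
      using B by (intro sum.cong) (auto simp: I_def transport_plan_def)
    finally have le: "B z \<le> (\<Sum>u\<in>X. r u)" .
    from B z have "B z \<in> \<int>" unfolding I_def by blast
    then obtain k where k: "B z = of_int k" by (rule Ints_cases)
    have "0 \<le> k" using nonneg[OF z] k by simp
    moreover have "k \<le> K" using le k by (simp add: K_def le_floor_iff)
    ultimately show "B z \<in> of_int ` {0..K}" using k by auto
  qed
  have "finite (X \<times> Y \<rightarrow>\<^sub>E (of_int ` {0..K} :: real set))"
    using X Y by (intro finite_PiE) auto
  \<comment> \<open>Plans may differ arbitrarily off \<open>X \<times> Y\<close>, so finiteness is
    claimed for the costs and not for \<open>I\<close>; restricting a plan to
    \<open>X \<times> Y\<close> keeps its cost.\<close>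
  moreover have "cost ` I \<subseteq> cost ` (X \<times> Y \<rightarrow>\<^sub>E of_int ` {0..K})"
  proof
    fix k assume "k \<in> cost ` I"
    then obtain B where B: "B \<in> I" "k = cost B" by auto
    have "cost B = cost (restrict B (X \<times> Y))"
      unfolding cost_def by (intro sum.cong) auto
    with B bound show "k \<in> cost ` (X \<times> Y \<rightarrow>\<^sub>E of_int ` {0..K})" by blast
  qed
  ultimately have fin: "finite (cost ` I)" by (meson finite_imageI finite_subset)
  have le: "\<exists>B\<in>I. cost B \<le> cost A'" if "transport_plan X Y r s A'" for A'
    using ex_integral_transport_plan_le[OF X Y r s that, where c = c]
    by (auto simp: I_def cost_def)
  from le[OF A] have "cost ` I \<noteq> {}" by auto
  from Min_in[OF fin this] obtain B where B: "B \<in> I" "cost B = Min (cost ` I)" by auto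
  have "cost B \<le> cost A'" if "transport_plan X Y r s A'" for A'
  proof -
    from le[OF that] obtain B' where B': "B' \<in> I" "cost B' \<le> cost A'" by auto
    then show ?thesis using Min_le[OF fin, of "cost B'"] B(2) by auto
  qed
  with B(1) show thesis by (intro that[of B]) (auto simp: I_def cost_def)
qed

text \<open>A positive integer is at least 1, so each positive term contributes at least 1 to the
  sum. This is how integrality yields sparsity.\<close>

lemma card_pos_le_sum_of_integers:
  fixes f :: "'i \<Rightarrow> real"
  assumes "finite I" and "\<And>i. i \<in> I \<Longrightarrow> 0 \<le> f i \<and> f i \<in> \<int>" and "sum f I = real k"
  shows "card {i \<in> I. f i > 0} \<le> k"
proof -
  have "of_bool (f i > 0) \<le> f i" if i: "i \<in> I" for i
  proof -
    from assms(2)[OF i] obtain l where "f i = of_int l" by (auto elim: Ints_cases)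
    with assms(2)[OF i] show ?thesis by auto
  qed
  then have "(\<Sum>i\<in>I. of_bool (f i > 0)) \<le> sum f I" by (intro sum_mono) auto
  then show ?thesis using assms by (simp add: Int_def)
qed

subsection \<open>Couplings of uniform measures on finite sets\<close>

lemma sets_pair_uniform_count_measure:
  assumes "finite X" "finite Y"
  shows "sets (uniform_count_measure X \<Otimes>\<^sub>M uniform_count_measure Y) = Pow (X \<times> Y)"
proof -
  have "sets (uniform_count_measure X \<Otimes>\<^sub>M uniform_count_measure Y)
      = sets (count_space X \<Otimes>\<^sub>M count_space Y)"
    by (intro sets_pair_measure_cong) (simp_all add: sets_uniform_count_measure)
  also have "\<dots> = Pow (X \<times> Y)" using assms by (subst pair_measure_count_space) simp_all
  finally show ?thesis .
qed

text \<open>Measures on a finite set with all subsets measurable are determined by singletons, so a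
  marginal condition amounts to finitely many real equations.\<close>

lemma distr_eq_uniform_count_measure_iff:
  assumes X: "finite X" "X \<noteq> {}" and \<gamma>: "finite_measure \<gamma>" and f: "f \<in> \<gamma> \<rightarrow>\<^sub>M count_space X"
  shows "distr \<gamma> (uniform_count_measure X) f = uniform_count_measure X \<longleftrightarrow>
    (\<forall>u\<in>X. measure \<gamma> (f -` {u} \<inter> space \<gamma>) = 1 / card X)"
proof -
  interpret finite_measure \<gamma> by fact
  have f': "f \<in> \<gamma> \<rightarrow>\<^sub>M uniform_count_measure X"
    using f by (simp add: measurable_cong_sets[OF refl, of "uniform_count_measure X" "count_space X"]
        sets_uniform_count_measure)
  have L: "emeasure (distr \<gamma> (uniform_count_measure X) f) {u} =
      ennreal (measure \<gamma> (f -` {u} \<inter> space \<gamma>))" if "u \<in> X" for u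
    using that f' by (subst emeasure_distr) (auto simp: sets_uniform_count_measure emeasure_eq_measure)
  have R: "emeasure (uniform_count_measure X) {u} = ennreal (1 / card X)" if "u \<in> X" for u
    using that X by (simp add: emeasure_uniform_count_measure)
  show ?thesis
  proof
    assume eq: "distr \<gamma> (uniform_count_measure X) f = uniform_count_measure X"
    show "\<forall>u\<in>X. measure \<gamma> (f -` {u} \<inter> space \<gamma>) = 1 / card X"
    proof
      fix u assume u: "u \<in> X"
      have "ennreal (measure \<gamma> (f -` {u} \<inter> space \<gamma>)) = ennreal (1 / card X)"
        using L[OF u] R[OF u] eq by simp
      then show "measure \<gamma> (f -` {u} \<inter> space \<gamma>) = 1 / card X"
        by (subst (asm) ennreal_inj) auto
    qed
  next
    assume "\<forall>u\<in>X. measure \<gamma> (f -` {u} \<inter> space \<gamma>) = 1 / card X"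
    then show "distr \<gamma> (uniform_count_measure X) f = uniform_count_measure X"
      using X L R
      by (intro measure_eqI_finite[of _ X]) (auto simp: sets_uniform_count_measure)
  qed
qed

text \<open>Finite additivity, indexed so that fibres of the projections turn into row and column
  sums.\<close>

lemma measure_eq_sum_image:
  assumes "sets \<gamma> = Pow S" "finite_measure \<gamma>" "finite J" "inj_on g J" "g ` J \<subseteq> S"
  shows "measure \<gamma> (g ` J) = (\<Sum>j\<in>J. measure \<gamma> {g j})"
proof -
  interpret finite_measure \<gamma> by fact
  have "measure \<gamma> (g ` J) = (\<Sum>z\<in>g ` J. measure \<gamma> {z})"
    using assms by (intro finite_measure_eq_sum_singleton) auto
  then show ?thesis using assms(4) by (simp add: sum.reindex)
qed

text \<open>The dictionary between measures and matrices: the marginals of \<open>\<gamma>\<close>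
  are the row and column sums of its point masses.\<close>

lemma couplings_uniform_count_measure_iff:
  assumes X: "finite X" "X \<noteq> {}" and Y: "finite Y" "Y \<noteq> {}"
    and \<gamma>: "finite_measure \<gamma>" "sets \<gamma> = Pow (X \<times> Y)"
  shows "\<gamma> \<in> couplings (uniform_count_measure X) (uniform_count_measure Y) \<longleftrightarrow>
    transport_plan X Y (\<lambda>_. 1 / card X) (\<lambda>_. 1 / card Y) (\<lambda>z. measure \<gamma> {z})"
proof -
  have sp: "space \<gamma> = X \<times> Y" using sets_eq_imp_space_eq[of \<gamma> "count_space (X \<times> Y)"] \<gamma> by simp
  have meas: "f \<in> \<gamma> \<rightarrow>\<^sub>M count_space Z" if "f \<in> X \<times> Y \<rightarrow> Z" for f and Z :: "'z set"
    using that \<gamma>(2) sp by (auto simp: measurable_def)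
  have fst: "measure \<gamma> (fst -` {u} \<inter> space \<gamma>) = (\<Sum>v\<in>Y. measure \<gamma> {(u, v)})" if "u \<in> X" for u
  proof -
    have "fst -` {u} \<inter> space \<gamma> = Pair u ` Y" using that sp by auto
    then show ?thesis using measure_eq_sum_image[OF \<gamma>(2,1) Y(1), of "Pair u"] that
      by (auto simp: inj_on_def)
  qed
  have snd: "measure \<gamma> (snd -` {v} \<inter> space \<gamma>) = (\<Sum>u\<in>X. measure \<gamma> {(u, v)})" if "v \<in> Y" for v
  proof -
    have "snd -` {v} \<inter> space \<gamma> = (\<lambda>u. (u, v)) ` X" using that sp by auto
    then show ?thesis using measure_eq_sum_image[OF \<gamma>(2,1) X(1), of "\<lambda>u. (u, v)"] that
      by (auto simp: inj_on_def)
  qed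
  \<comment> \<open>Total mass 1 is implied by the margins: \<open>card X\<close> rows each carry
    mass \<open>1 / card X\<close>.\<close>
  have prob: "prob_space \<gamma>"
    if "transport_plan X Y (\<lambda>_. 1 / card X) (\<lambda>_. 1 / card Y) (\<lambda>z. measure \<gamma> {z})"
  proof -
    have "measure \<gamma> (space \<gamma>) = (\<Sum>z\<in>X \<times> Y. measure \<gamma> {z})"
      using measure_eq_sum_image[OF \<gamma>(2,1), of "X \<times> Y" "\<lambda>z. z"] X Y sp by simp
    also have "\<dots> = (\<Sum>u\<in>X. 1 / card X)"
      unfolding sum.cartesian_product'
      using that by (intro sum.cong) (auto simp: transport_plan_def)
    also have "\<dots> = 1" using X by simp
    finally show ?thesis
      using \<gamma>(1) by (intro prob_spaceI) (simp add: finite_measure.emeasure_eq_measure)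
  qed
  have "distr \<gamma> (uniform_count_measure X) fst = uniform_count_measure X \<longleftrightarrow>
      (\<forall>u\<in>X. (\<Sum>v\<in>Y. measure \<gamma> {(u, v)}) = 1 / card X)"
    using distr_eq_uniform_count_measure_iff[OF X \<gamma>(1) meas[of fst X]] fst by fastforce
  moreover have "distr \<gamma> (uniform_count_measure Y) snd = uniform_count_measure Y \<longleftrightarrow>
      (\<forall>v\<in>Y. (\<Sum>u\<in>X. measure \<gamma> {(u, v)}) = 1 / card Y)"
    using distr_eq_uniform_count_measure_iff[OF Y \<gamma>(1) meas[of snd Y]] snd by fastforce
  ultimately show ?thesis
    using prob \<gamma>(2) sets_pair_uniform_count_measure[OF X(1) Y(1)]
    by (auto simp: couplings_def transport_plan_def)
qed

text \<open>Such a measure is the point measure with its own singleton masses as weights.\<close>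

lemma integral_finite_Pow:
  fixes c :: "'z \<Rightarrow> real"
  assumes "finite S" "finite_measure \<gamma>" "sets \<gamma> = Pow S"
  shows "integral\<^sup>L \<gamma> c = (\<Sum>z\<in>S. c z * measure \<gamma> {z})"
proof -
  interpret finite_measure \<gamma> by fact
  have "\<gamma> = point_measure S (\<lambda>z. ennreal (measure \<gamma> {z}))"
    using assms
    by (intro measure_eqI_finite[of _ S])
      (auto simp: sets_point_measure emeasure_point_measure_finite emeasure_eq_measure)
  then have "integral\<^sup>L \<gamma> c = integral\<^sup>L (point_measure S (\<lambda>z. ennreal (measure \<gamma> {z}))) c"
    by simp
  also have "\<dots> = (\<Sum>z\<in>S. measure \<gamma> {z} * c z)"
    using assms by (subst lebesgue_integral_point_measure_finite) auto
  finally show ?thesis by (simp add: mult.commute)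
qed

section \<open>Sparse solutions by scaling\<close>

lemma transport_plan_scale:
  assumes "transport_plan X Y r s A" "k \<ge> 0"
  shows "transport_plan X Y (\<lambda>u. k * r u) (\<lambda>v. k * s v) (\<lambda>z. k * A z)"
  using assms by (simp add: transport_plan_def sum_distrib_left[symmetric])

text \<open>After scaling by \<open>k\<close>, the margins are the integers \<open>q\<close> and
  \<open>p\<close>. An integral optimal plan exists there, its margins bound its support, and
  dividing by \<open>k\<close> changes neither optimality nor support.\<close>

lemma ex_sparse_kantorovich_solution:
  fixes c :: "'a \<times> 'b \<Rightarrow> real"
  assumes X: "finite X" "X \<noteq> {}" and Y: "finite Y" "Y \<noteq> {}"
  obtains \<gamma> where "kantorovich_solution (uniform_count_measure X) (uniform_count_measure Y) c \<gamma>"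
    "\<And>u. u \<in> X \<Longrightarrow> card {v \<in> Y. measure \<gamma> {(u, v)} > 0} \<le> card Y div gcd (card X) (card Y)"
    "\<And>v. v \<in> Y \<Longrightarrow> card {u \<in> X. measure \<gamma> {(u, v)} > 0} \<le> card X div gcd (card X) (card Y)"
proof -
  define m n g where "m = card X" and "n = card Y" and "g = gcd m n"
  define p q where "p = m div g" and "q = n div g"
  have pos: "0 < m" "0 < n" "0 < g" using X Y by (auto simp: m_def n_def g_def card_gt_0_iff)
  have m_eq: "m = g * p" and n_eq: "n = g * q" by (auto simp: p_def q_def g_def)
  \<comment> \<open>As \<open>m = g * p\<close> and \<open>n = g * q\<close>, this is
    \<open>lcm m n\<close>; hence \<open>k / m = q\<close> and \<open>k / n = p\<close>.\<close>
  define k where "k = real (g * p * q)"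
  have k: "k > 0" using pos m_eq n_eq by (simp add: k_def)
  have km: "k * (1 / real m) = real q" and kn: "k * (1 / real n) = real p"
    using pos by (simp_all add: k_def m_eq n_eq)
  let ?M = "uniform_count_measure X" and ?N = "uniform_count_measure Y"
  let ?r = "\<lambda>_::'a. real q" and ?s = "\<lambda>_::'b. real p"
  \<comment> \<open>Feasibility is witnessed by the scaled product coupling:
    \<open>k / (m * n) = 1 / g\<close>.\<close>
  have "transport_plan X Y ?r ?s (\<lambda>_. 1 / real g)"
    using pos by (simp add: transport_plan_def m_eq n_eq flip: m_def n_def)
  then obtain B where B: "transport_plan X Y ?r ?s B" "\<And>z. z \<in> X \<times> Y \<Longrightarrow> B z \<in> \<int>"
    "\<And>A'. transport_plan X Y ?r ?s A' \<Longrightarrow>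
       (\<Sum>z\<in>X \<times> Y. c z * B z) \<le> (\<Sum>z\<in>X \<times> Y. c z * A' z)"
    using ex_integral_optimal_transport_plan[OF X(1) Y(1), of ?r ?s _ c] by auto
  define \<gamma> where "\<gamma> = point_measure (X \<times> Y) (\<lambda>z. ennreal (B z / k))"
  have B0: "0 \<le> B z" if "z \<in> X \<times> Y" for z using B(1) that by (auto simp: transport_plan_def)
  have fin: "finite (X \<times> Y)" using X Y by simp
  have sets: "sets \<gamma> = Pow (X \<times> Y)" by (simp add: \<gamma>_def sets_point_measure)
  have finm: "finite_measure \<gamma>"
    using fin by (intro finite_measureI)
      (simp add: \<gamma>_def space_point_measure emeasure_point_measure_finite)
  have meas: "measure \<gamma> {z} = B z / k" if "z \<in> X \<times> Y" for z
    using that fin B0 k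
    by (simp add: \<gamma>_def measure_def emeasure_point_measure_finite)
  have "transport_plan X Y (\<lambda>_. (1 / k) * real q) (\<lambda>_. (1 / k) * real p) (\<lambda>z. (1 / k) * B z)"
    using transport_plan_scale[OF B(1), of "1 / k"] k by simp
  moreover have "(1 / k) * real q = 1 / m" "(1 / k) * real p = 1 / n"
    using km kn k by (simp_all add: field_simps)
  ultimately have "transport_plan X Y (\<lambda>_. 1 / card X) (\<lambda>_. 1 / card Y) (\<lambda>z. measure \<gamma> {z})"
    using meas by (simp add: transport_plan_def flip: m_def n_def)
  then have coupling: "\<gamma> \<in> couplings ?M ?N"
    using couplings_uniform_count_measure_iff[OF X Y finm sets] by simp
  \<comment> \<open>A competing coupling is scaled up by \<open>k\<close>, compared with
    \<open>B\<close>, and the common factor \<open>k > 0\<close> is cancelled.\<close>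
  have "integral\<^sup>L \<gamma> c \<le> integral\<^sup>L \<gamma>' c" if \<gamma>': "\<gamma>' \<in> couplings ?M ?N" for \<gamma>'
  proof -
    have finm': "finite_measure \<gamma>'" and sets': "sets \<gamma>' = Pow (X \<times> Y)"
      using \<gamma>' sets_pair_uniform_count_measure[OF X(1) Y(1)]
      by (auto simp: couplings_def prob_space_def)
    have "transport_plan X Y (\<lambda>_. 1 / m) (\<lambda>_. 1 / n) (\<lambda>z. measure \<gamma>' {z})"
      using couplings_uniform_count_measure_iff[OF X Y finm' sets'] \<gamma>' by (simp add: m_def n_def)
    from transport_plan_scale[OF this, of k] k
    have "transport_plan X Y ?r ?s (\<lambda>z. k * measure \<gamma>' {z})" unfolding km kn by simp
    from B(3)[OF this] have "(\<Sum>z\<in>X \<times> Y. c z * B z) \<le> k * (\<Sum>z\<in>X \<times> Y. c z * measure \<gamma>' {z})"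
      by (simp add: sum_distrib_left mult_ac)
    moreover have "(\<Sum>z\<in>X \<times> Y. c z * B z) = k * (\<Sum>z\<in>X \<times> Y. c z * measure \<gamma> {z})"
      unfolding sum_distrib_left using k meas by (intro sum.cong) auto
    ultimately show ?thesis
      using k integral_finite_Pow[OF fin finm sets, of c] integral_finite_Pow[OF fin finm' sets', of c]
      by simp
  qed
  with coupling have "kantorovich_solution ?M ?N c \<gamma>" by (simp add: kantorovich_solution_def)
  \<comment> \<open>Dividing by \<open>k\<close> preserves positivity, and row \<open>u\<close> of
    \<open>B\<close> consists of nonnegative integers with sum \<open>q\<close>.\<close>
  moreover have "card {v \<in> Y. measure \<gamma> {(u, v)} > 0} \<le> q" if u: "u \<in> X" for u
  proof -
    have "{v \<in> Y. measure \<gamma> {(u, v)} > 0} = {v \<in> Y. B (u, v) > 0}"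
      using meas u k by (auto simp: zero_less_divide_iff)
    then show ?thesis
      using card_pos_le_sum_of_integers[OF Y(1), of "\<lambda>v. B (u, v)" q] B u
      by (simp add: transport_plan_def)
  qed
  moreover have "card {u \<in> X. measure \<gamma> {(u, v)} > 0} \<le> p" if v: "v \<in> Y" for v
  proof -
    have "{u \<in> X. measure \<gamma> {(u, v)} > 0} = {u \<in> X. B (u, v) > 0}"
      using meas v k by (auto simp: zero_less_divide_iff)
    then show ?thesis
      using card_pos_le_sum_of_integers[OF X(1), of "\<lambda>u. B (u, v)" p] B v
      by (simp add: transport_plan_def)
  qed
  ultimately show thesis
    by (intro that[of \<gamma>]) (simp_all add: p_def q_def g_def m_def n_def)
qed

section \<open>From sets of points to indexed points\<close>

lemma card_Collect_image:
  assumes "inj_on f I"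
  shows "card {i \<in> I. P (f i)} = card {u \<in> f ` I. P u}"
proof -
  have "{u \<in> f ` I. P u} = f ` {i \<in> I. P (f i)}" by auto
  then show ?thesis using assms by (simp add: card_image inj_on_subset)
qed

theorem mainTheorem1:
  fixes m n :: nat
    and x :: "nat \<Rightarrow> 'a" and y :: "nat \<Rightarrow> 'b"
    and c :: "'a \<times> 'b \<Rightarrow> real"
  assumes "m \<ge> 1" and "n \<ge> 1"
    and "inj_on x {1..m}" and "inj_on y {1..n}"
  shows "\<exists>\<gamma>. kantorovich_solution (dirac_average m x) (dirac_average n y) c \<gamma> \<and>
      (\<forall>i \<in> {1..m}. card {j \<in> {1..n}. measure \<gamma> {(x i, y j)} > 0} \<le> n div gcd m n) \<and>
      (\<forall>j \<in> {1..n}. card {i \<in> {1..m}. measure \<gamma> {(x i, y j)} > 0} \<le> m div gcd m n)"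
proof -
  let ?X = "x ` {1..m}" and ?Y = "y ` {1..n}"
  have card: "card ?X = m" "card ?Y = n" using assms by (simp_all add: card_image)
  have "finite ?X" "?X \<noteq> {}" "finite ?Y" "?Y \<noteq> {}" using assms(1,2) by auto
  then obtain \<gamma> where \<gamma>:
    "kantorovich_solution (uniform_count_measure ?X) (uniform_count_measure ?Y) c \<gamma>"
    "\<And>u. u \<in> ?X \<Longrightarrow> card {v \<in> ?Y. measure \<gamma> {(u, v)} > 0} \<le> n div gcd m n"
    "\<And>v. v \<in> ?Y \<Longrightarrow> card {u \<in> ?X. measure \<gamma> {(u, v)} > 0} \<le> m div gcd m n"
    by (rule ex_sparse_kantorovich_solution[of ?X ?Y c, unfolded card]) blast
  show ?thesis
  proof (intro exI[of _ \<gamma>] conjI ballI)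
    \<comment> \<open>Since the points are distinct, each average of Dirac measures is the uniform
      measure on its set of points.\<close>
    show "kantorovich_solution (dirac_average m x) (dirac_average n y) c \<gamma>"
      using \<gamma>(1) assms(3,4) by (simp add: dirac_average_eq_uniform_count_measure)
  next
    fix i assume "i \<in> {1..m}"
    then show "card {j \<in> {1..n}. measure \<gamma> {(x i, y j)} > 0} \<le> n div gcd m n"
      using \<gamma>(2) card_Collect_image[OF assms(4), of "\<lambda>v. measure \<gamma> {(x i, v)} > 0"] by simp
  next
    fix j assume "j \<in> {1..n}"
    then show "card {i \<in> {1..m}. measure \<gamma> {(x i, y j)} > 0} \<le> m div gcd m n"
      using \<gamma>(3) card_Collect_image[OF assms(3), of "\<lambda>u. measure \<gamma> {(u, y j)} > 0"] by simp
  qed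
qed

end
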